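(* Let $d\ge1$, $1\le p<\infty$, and let $\nu:\mathbb{R}^d\setminus\{0\}\to[0,\infty)$ be measurable. Let $w:[0,\infty)\to[0,\infty)$, $w(r)=(r\,\nu^\#(r))^{1/p}$, be the potential associated with $\nu$ (see context). Assume that $r\mapsto w(r)$ is invertible (from $[0,\infty)$ to $[0,\infty)$), that $t\mapsto\phi_p(t)=\phi(t^{1/p})$ is a Young function, where $\phi(t)=1/w^{-1}(1/t)$, and that there is $\theta>0$ such that $$\phi\Big(\theta\,\frac{s}{t}\Big)\le\frac{\phi(s)}{\phi(t)}\qquad\text{for all }0\le s\le t,\ t>0.$$ For $t\ge2$ (with $t>2$ if $p=1$) define $C_p(t)=\frac{t^p-2}{t^p-1}$ and $\Theta_t=t\,[2C_p(t)\,\phi(\theta/t)]^{-1/p}$. Then $$\|u\|_{L^\phi(\mathbb{R}^d)}\le\Theta_t\Big(\int_{\mathbb{R}^d}\int_{\mathbb{R}^d}|u(x)-u(y)|^p\,\nu(x-y)\,dy\,dx\Big)^{1/p}\qquad\text{for all }u\in L^\phi(\mathbb{R}^d).$$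
   Context: $|E|$ is Lebesgue measure, $c_d=|B(0,1)|$ the volume of the unit ball, $\eta(r)=(r/c_d)^{1/d}$. The symmetric decreasing rearrangement of $\nu$ is the radial function $\nu^*(\rho)=\inf\{s>0:|\{\nu>s\}|\le c_d\rho^d\}$, $\rho\ge0$. Define $$\nu^\#(r)=\int_{\{\nu<\nu^*(\eta(r))\}}\nu(h)\,dh,\qquad w(r)=(r\,\nu^\#(r))^{1/p}\ (r>0),\quad w(0)=0,$$ and $\phi(t)=1/w^{-1}(1/t)$ for $t>0$, $\phi(0)=0$. A Young function is a convex function $\phi:[0,\infty]\to[0,\infty]$ with $\phi(0)=0$, not identically $0$ and not identically $\infty$ on $(0,\infty)$. $L^\phi(\mathbb{R}^d)$ is the Orlicz space of measurable $u:\mathbb{R}^d\to\mathbb{R}$ with $\int\phi(|u|/\lambda)\,dx<\infty$ for some $\lambda>0$, with Luxemburg norm $\|u\|_{L^\phi(\mathbb{R}^d)}=\inf\{\lambda>0:\int_{\mathbb{R}^d}\phi(|u(x)|/\lambda)\,dx\le1\}$. The right-hand side of the inequality may be $+\infty$. *)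

theory Defs
  imports "HOL-Analysis.Analysis"
begin

text \<open>Real powers on \<open>[0,\<infinity>]\<close>; the value at infinity is the right one for positive exponents only,
  and only these are used.\<close>
definition ennpowr :: "ennreal \<Rightarrow> real \<Rightarrow> ennreal"  (infixr "epowr" 80)
  where "x epowr a = (if x = \<infinity> then \<infinity> else ennreal (enn2real x powr a))"

definition eta :: "'a::euclidean_space itself \<Rightarrow> real \<Rightarrow> real"
  where "eta _ r = (r / measure lebesgue (ball (0::'a) 1)) powr (1 / real DIM('a))"

text \<open>A function \<open>\<nu>\<close> on the punctured space is represented by a total function whose value at the
  origin is never used. The infimum of the empty set is \<open>\<infinity>\<close>, so \<open>\<nu>\<^sup>*\<close> may take the value \<open>\<infinity>\<close>.\<close>
definition nu_star :: "('a::euclidean_space \<Rightarrow> real) \<Rightarrow> real \<Rightarrow> ennreal"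
  where "nu_star \<nu> \<rho> = Inf {ennreal s | s. 0 < s \<and>
     emeasure lebesgue {h. h \<noteq> 0 \<and> \<nu> h > s}
       \<le> ennreal (measure lebesgue (ball (0::'a) 1) * \<rho> ^ DIM('a))}"

definition nu_sharp :: "('a::euclidean_space \<Rightarrow> real) \<Rightarrow> real \<Rightarrow> ennreal"
  where "nu_sharp \<nu> r =
     (\<integral>\<^sup>+ h \<in> {h. h \<noteq> 0 \<and> ennreal (\<nu> h) < nu_star \<nu> (eta TYPE('a) r)}. ennreal (\<nu> h) \<partial>lebesgue)"

text \<open>This is the intended real-valued function only if \<open>\<nu>\<^sup>#(r) < \<infinity>\<close> for all \<open>r > 0\<close>, since
  \<^const>\<open>enn2real\<close> sends \<open>\<infinity>\<close> to \<open>0\<close>; finiteness has to be assumed along with it.\<close>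
definition potential :: "real \<Rightarrow> ('a::euclidean_space \<Rightarrow> real) \<Rightarrow> real \<Rightarrow> real"
  where "potential p \<nu> r = (if r = 0 then 0 else (r * enn2real (nu_sharp \<nu> r)) powr (1 / p))"

text \<open>\<open>\<phi>(t) = 1 / w\<inverse>(1/t)\<close> on \<open>[0,\<infinity>]\<close>, for \<open>w\<close> a bijection of \<open>[0,\<infinity>)\<close>. With the conventions of
  \<^typ>\<open>ennreal\<close> and \<open>w(0) = 0\<close>, the formula gives \<open>\<phi>(\<infinity>) = 1 / w\<inverse>(0) = 1 / 0 = \<infinity>\<close>.\<close>
definition phi :: "(real \<Rightarrow> real) \<Rightarrow> ennreal \<Rightarrow> ennreal"
  where "phi w t = (if t = 0 then 0 else 1 / ennreal (the_inv_into {0..} w (enn2real (1 / t))))"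

definition young_function :: "(ennreal \<Rightarrow> ennreal) \<Rightarrow> bool"
  where "young_function \<Phi> \<longleftrightarrow>
     \<Phi> 0 = 0 \<and>
     (\<forall>x y a. 0 \<le> a \<and> a \<le> 1 \<longrightarrow>
        \<Phi> (ennreal a * x + ennreal (1 - a) * y) \<le> ennreal a * \<Phi> x + ennreal (1 - a) * \<Phi> y) \<and>
     (\<exists>x. 0 < x \<and> x < \<infinity> \<and> \<Phi> x \<noteq> 0) \<and>
     (\<exists>x. 0 < x \<and> x < \<infinity> \<and> \<Phi> x \<noteq> \<infinity>)"

definition orlicz_space :: "(ennreal \<Rightarrow> ennreal) \<Rightarrow> ('a::euclidean_space \<Rightarrow> real) set"
  where "orlicz_space \<Phi> = {u. u \<in> borel_measurable lebesgue \<and>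
     (\<exists>l>0. (\<integral>\<^sup>+ x. \<Phi> (ennreal (\<bar>u x\<bar> / l)) \<partial>lebesgue) < \<infinity>)}"

definition luxemburg_norm :: "(ennreal \<Rightarrow> ennreal) \<Rightarrow> ('a::euclidean_space \<Rightarrow> real) \<Rightarrow> ennreal"
  where "luxemburg_norm \<Phi> u =
     Inf {ennreal l | l. 0 < l \<and> (\<integral>\<^sup>+ x. \<Phi> (ennreal (\<bar>u x\<bar> / l)) \<partial>lebesgue) \<le> 1}"

definition C_const :: "real \<Rightarrow> real \<Rightarrow> real"
  where "C_const p t = (t powr p - 2) / (t powr p - 1)"

text \<open>The argument \<open>\<Phi>\<close> will be \<^const>\<open>phi\<close> of a bijection \<open>w\<close> of \<open>[0,\<infinity>)\<close> with \<open>w(0) = 0\<close>, which is finite at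
  every real point, so \<^const>\<open>enn2real\<close> loses nothing.\<close>
definition Theta_const :: "(ennreal \<Rightarrow> ennreal) \<Rightarrow> real \<Rightarrow> real \<Rightarrow> real \<Rightarrow> real"
  where "Theta_const \<Phi> p \<theta> t =
     t * (2 * C_const p t * enn2real (\<Phi> (ennreal (\<theta> / t)))) powr (- 1 / p)"

end

theory Submission
  imports Defs
begin

text \<open>
  If \<open>D\<close> has measure \<open>r\<close>, then \<open>\<integral>\<close> of \<open>\<nu>\<close> over the complement of \<open>D\<close> is at least \<open>\<nu>\<^sup>#(r)\<close>
  (bathtub principle). Hence, for a bounded \<open>v \<ge> 0\<close> with support of finite measure and levels
  \<open>T\<^sub>n = T / t\<^sup>n\<close>, \<open>b\<^sub>n = |{v > T\<^sub>n}|\<close>, the pairs with \<open>v(x) > T\<^sub>n\<close> and \<open>v(y) \<le> T\<^sub>n\<^sub>+\<^sub>1\<close>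
  contribute at least \<open>T\<^sub>n\<^sub>+\<^sub>1\<^sup>p b\<^sub>n \<nu>\<^sup>#(b\<^sub>n\<^sub>+\<^sub>1) = T\<^sub>n\<^sub>+\<^sub>1\<^sup>p w(b\<^sub>n\<^sub>+\<^sub>1)\<^sup>p b\<^sub>n / b\<^sub>n\<^sub>+\<^sub>1\<close> to the
  energy (twice, by exchanging \<open>x\<close> and \<open>y\<close>), up to the factor \<open>1 - t\<^sup>-\<^sup>p \<ge> C\<^sub>p(t)\<close> that pays for pairs counted
  at several levels. The condition on \<open>\<phi>\<close> gives \<open>b\<^sub>n / b\<^sub>n\<^sub>+\<^sub>1 \<ge> \<phi>(\<theta> w(b\<^sub>n) / w(b\<^sub>n\<^sub>+\<^sub>1))\<close>, and Jensen's
  inequality for \<open>\<phi>\<^sub>p\<close> with weights \<open>T\<^sub>n\<^sub>+\<^sub>1\<^sup>p w(b\<^sub>n\<^sub>+\<^sub>1)\<^sup>p\<close> bounds the energy below by \<open>\<phi>(\<theta>/t)\<close> times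
  the sum of the weights. That sum is at least \<open>t\<^sup>-\<^sup>p\<close> as soon as \<open>\<integral> \<phi>(v) > 1\<close>. A general \<open>u\<close> is
  reduced to such \<open>v\<close> by truncation and Fatou's lemma.
\<close>

section \<open>Bathtub principle for \<open>\<nu>\<^sup>#\<close>\<close>

text \<open>Since \<open>D\<close> is no larger than \<open>{s \<le> f}\<close>, cancelling the
  common part shows that \<open>D\<close> meets \<open>{f < s}\<close> in measure at most that of
  \<open>{s \<le> f} - D\<close>. Exchanging the first piece, where \<open>f < s\<close>, for the
  second, where \<open>s \<le> f\<close>, can only increase the integral.\<close>

lemma set_nn_integral_sublevel_le:
  fixes f :: "'b \<Rightarrow> ennreal"
  assumes f[measurable]: "f \<in> borel_measurable M" and D[measurable]: "D \<in> sets M"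
    and Dr: "emeasure M D \<le> r" "emeasure M D < \<infinity>"
    and rs: "r \<le> emeasure M {x \<in> space M. s \<le> f x}"
  shows "(\<integral>\<^sup>+ x \<in> {x. f x < s}. f x \<partial>M) \<le> (\<integral>\<^sup>+ x \<in> - D. f x \<partial>M)"
proof -
  let ?L = "{x \<in> space M. f x < s}" and ?H = "{x \<in> space M. s \<le> f x}"
  have 1: "emeasure M D = emeasure M (D \<inter> ?L) + emeasure M (D \<inter> ?H)"
    using sets.sets_into_space[OF D]
    by (subst plus_emeasure) (auto intro!: arg_cong[of _ _ "emeasure M"])
  have 2: "emeasure M ?H = emeasure M (?H - D) + emeasure M (D \<inter> ?H)"
    by (subst plus_emeasure) (auto intro!: arg_cong[of _ _ "emeasure M"])
  have "emeasure M (D \<inter> ?H) \<le> emeasure M D"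
    by (intro emeasure_mono) auto
  then have fin: "emeasure M (D \<inter> ?H) \<noteq> \<infinity>"
    using Dr(2) by auto
  have "emeasure M (D \<inter> ?H) + emeasure M (D \<inter> ?L) \<le> emeasure M (D \<inter> ?H) + emeasure M (?H - D)"
    using order.trans[OF Dr(1) rs] unfolding 1 2 by (simp only: add.commute)
  then have 3: "emeasure M (D \<inter> ?L) \<le> emeasure M (?H - D)"
    using fin unfolding ennreal_add_left_cancel_le by simp
  have "(\<integral>\<^sup>+ x. f x * indicator (D \<inter> ?L) x \<partial>M) \<le> (\<integral>\<^sup>+ x. s * indicator (D \<inter> ?L) x \<partial>M)"
    by (intro nn_integral_mono) (auto simp: indicator_def)
  also have "\<dots> = s * emeasure M (D \<inter> ?L)"
    by (rule nn_integral_cmult_indicator) auto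
  also have "\<dots> \<le> s * emeasure M (?H - D)"
    using 3 by (rule mult_left_mono) auto
  also have "\<dots> = (\<integral>\<^sup>+ x. s * indicator (?H - D) x \<partial>M)"
    by (rule nn_integral_cmult_indicator[symmetric]) auto
  also have "\<dots> \<le> (\<integral>\<^sup>+ x. f x * indicator (?H - D) x \<partial>M)"
    by (intro nn_integral_mono) (auto simp: indicator_def)
  finally have 4: "(\<integral>\<^sup>+ x. f x * indicator (D \<inter> ?L) x \<partial>M) \<le> (\<integral>\<^sup>+ x. f x * indicator (?H - D) x \<partial>M)" .
  have "(\<integral>\<^sup>+ x \<in> {x. f x < s}. f x \<partial>M) =
      (\<integral>\<^sup>+ x. f x * indicator (?L - D) x + f x * indicator (D \<inter> ?L) x \<partial>M)"
    by (intro nn_integral_cong) (auto simp: indicator_def)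
  also have "\<dots> = (\<integral>\<^sup>+ x. f x * indicator (?L - D) x \<partial>M) + (\<integral>\<^sup>+ x. f x * indicator (D \<inter> ?L) x \<partial>M)"
    by (rule nn_integral_add) auto
  also have "\<dots> \<le> (\<integral>\<^sup>+ x. f x * indicator (?L - D) x \<partial>M) + (\<integral>\<^sup>+ x. f x * indicator (?H - D) x \<partial>M)"
    using 4 by (rule add_left_mono)
  also have "\<dots> = (\<integral>\<^sup>+ x. f x * indicator (?L - D) x + f x * indicator (?H - D) x \<partial>M)"
    by (rule nn_integral_add[symmetric]) auto
  also have "\<dots> = (\<integral>\<^sup>+ x \<in> - D. f x \<partial>M)"
    by (intro nn_integral_cong) (auto simp: indicator_def)
  finally show ?thesis .
qed

text \<open>Finiteness of the integral excludes that the superlevel sets have infinite measure below \<open>s\<close>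
  and measure less than \<open>r\<close> at \<open>s\<close>; in particular it excludes \<open>s = \<infinity>\<close> for real-valued \<open>f\<close>.\<close>

lemma emeasure_superlevel_ge:
  fixes f :: "'b \<Rightarrow> ennreal"
  assumes f[measurable]: "f \<in> borel_measurable M" and "0 < s"
    and gt: "\<And>s'. 0 < s' \<Longrightarrow> s' < s \<Longrightarrow> r < emeasure M {x \<in> space M. s' < f x}"
    and fin: "(\<integral>\<^sup>+ x \<in> {x. f x < s}. f x \<partial>M) < \<infinity>"
  shows "r \<le> emeasure M {x \<in> space M. s \<le> f x}"
proof (rule ccontr)
  assume neg: "\<not> r \<le> emeasure M {x \<in> space M. s \<le> f x}"
  then have finH: "emeasure M {x \<in> space M. s \<le> f x} < \<infinity>"
    by (metis infinity_ennreal_def not_le top.not_eq_extremum top_greatest)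
  obtain a0 where a0: "0 < a0" "a0 < s"
    using dense[OF \<open>0 < s\<close>] by auto
  obtain v where v: "\<And>n. v n < s" "v \<longlonglongrightarrow> s"
    using approx_from_below_dense_linorder[OF a0(2)] by auto
  \<comment> \<open>The running maximum makes the superlevel sets \<open>A n\<close> decreasing, as
    continuity from above requires. The floor \<open>a0 > 0\<close> keeps their measures
    finite.\<close>
  define v' where "v' = (\<lambda>n. Max ((\<lambda>k. max a0 (v k)) ` {..n}))"
  have v'lt: "v' n < s" and v'gt: "0 < v' n" and v'ge: "v n \<le> v' n" and v'a: "a0 \<le> v' n" for n
  proof -
    show "v' n < s"
      unfolding v'_def using v(1) a0(2) by (subst Max_less_iff) auto
    have "max a0 (v n) \<le> v' n"
      unfolding v'_def by (rule Max_ge) auto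
    then show "0 < v' n" "v n \<le> v' n" "a0 \<le> v' n"
      using a0(1) by auto
  qed
  have inc: "v' m \<le> v' n" if "m \<le> n" for m n
    unfolding v'_def using that by (intro Max_mono) auto
  \<comment> \<open>Chebyshev's inequality: the finite integral over \<open>{f < s}\<close> bounds
    the measure of the layer between \<open>a0\<close> and \<open>s\<close>.\<close>
  have "a0 * emeasure M {x \<in> space M. a0 < f x \<and> f x < s}
      = (\<integral>\<^sup>+ x. a0 * indicator {x \<in> space M. a0 < f x \<and> f x < s} x \<partial>M)"
    by (rule nn_integral_cmult_indicator[symmetric]) auto
  also have "\<dots> \<le> (\<integral>\<^sup>+ x \<in> {x. f x < s}. f x \<partial>M)"
    by (intro nn_integral_mono) (auto simp: indicator_def)
  finally have "a0 * emeasure M {x \<in> space M. a0 < f x \<and> f x < s} < \<infinity>"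
    using fin by auto
  then have finL: "emeasure M {x \<in> space M. a0 < f x \<and> f x < s} < \<infinity>"
    using a0(1) by (auto simp: ennreal_mult_less_top)
  define A where "A n = {x \<in> space M. v' n < f x}" for n
  have "emeasure M (A n) \<noteq> \<infinity>" for n
  proof -
    have "emeasure M (A n) \<le> emeasure M ({x \<in> space M. a0 < f x \<and> f x < s} \<union> {x \<in> space M. s \<le> f x})"
      unfolding A_def using v'a[of n] by (intro emeasure_mono) (auto simp: not_less)
    also have "\<dots> \<le> emeasure M {x \<in> space M. a0 < f x \<and> f x < s} + emeasure M {x \<in> space M. s \<le> f x}"
      by (rule emeasure_subadditive) auto
    also have "\<dots> < \<infinity>"
      using finL finH by auto
    finally show ?thesis by auto
  qed
  then have "(\<lambda>n. emeasure M (A n)) \<longlonglongrightarrow> emeasure M (\<Inter>n. A n)"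
    using inc by (intro Lim_emeasure_decseq) (auto simp: A_def decseq_def intro: le_less_trans)
  then have "r \<le> emeasure M (\<Inter>n. A n)"
    by (rule LIMSEQ_le_const) (use gt[OF v'gt v'lt] in \<open>auto simp: A_def intro: less_imp_le\<close>)
  also have "(\<Inter>n. A n) = {x \<in> space M. s \<le> f x}"
  proof safe
    fix x assume x: "x \<in> (\<Inter>n. A n)"
    then show "x \<in> space M" by (auto simp: A_def)
    have "v n \<le> f x" for n
      using x v'ge[of n] by (auto simp: A_def intro: order.trans less_imp_le)
    then show "s \<le> f x"
      by (intro LIMSEQ_le_const2[OF v(2)]) auto
  next
    fix x n assume "x \<in> space M" "s \<le> f x"
    then show "x \<in> A n"
      using v'lt[of n] by (auto simp: A_def)
  qed
  finally show False
    using neg by simp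
qed

lemma measure_ball_eta_power:
  assumes "0 < r"
  shows "measure lebesgue (ball (0::'a::euclidean_space) 1) * eta TYPE('a) r ^ DIM('a) = r"
proof -
  let ?c = "measure lebesgue (ball (0::'a) 1)"
  have c: "0 < ?c"
    using content_ball_pos[of 1 "0::'a"] by simp
  have "eta TYPE('a) r ^ DIM('a) = eta TYPE('a) r powr real DIM('a)"
    using assms c by (subst powr_realpow) (auto simp: eta_def)
  also have "\<dots> = r / ?c"
    using assms c by (simp add: eta_def powr_powr)
  finally show ?thesis
    using c by simp
qed

lemma borel_measurable_extend_zero:
  fixes \<nu> :: "'a::euclidean_space \<Rightarrow> real"
  assumes "\<nu> \<in> borel_measurable (lebesgue_on (- {0}))"
  shows "(\<lambda>h. if h = 0 then 0 else \<nu> h) \<in> borel_measurable lebesgue"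
proof -
  have "(\<lambda>h. if h \<in> - {0} then \<nu> h else 0) \<in> borel_measurable lebesgue"
    using assms by (subst borel_measurable_if) auto
  also have "(\<lambda>h. if h \<in> - {0} then \<nu> h else 0) = (\<lambda>h. if h = 0 then 0 else \<nu> h)"
    by auto
  finally show ?thesis .
qed

text \<open>The number \<open>s\<close> is an infimum of levels whose superlevel sets have measure
  at most \<open>r\<close>, so every positive level below \<open>s\<close> has a superlevel set of
  measure greater than \<open>r\<close>. This is what \<open>emeasure_superlevel_ge\<close> needs to
  supply the last hypothesis of \<open>set_nn_integral_sublevel_le\<close>. For \<open>s = 0\<close>
  the domain of integration of \<open>nu_sharp\<close> is empty.\<close>

lemma nu_sharp_le:
  fixes \<nu> :: "'a::euclidean_space \<Rightarrow> real"
  defines "g \<equiv> \<lambda>h. ennreal (if h = 0 then 0 else \<nu> h)"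
  assumes \<nu>: "\<nu> \<in> borel_measurable (lebesgue_on (- {0}))"
    and nonneg: "\<And>h. h \<noteq> 0 \<Longrightarrow> 0 \<le> \<nu> h"
    and "0 < r" and fin: "nu_sharp \<nu> r < \<infinity>"
    and D: "D \<in> sets lebesgue" "emeasure lebesgue D \<le> ennreal r"
  shows "nu_sharp \<nu> r \<le> (\<integral>\<^sup>+ h \<in> - D. g h \<partial>lebesgue)"
proof -
  have g[measurable]: "g \<in> borel_measurable lebesgue"
    unfolding g_def using borel_measurable_extend_zero[OF \<nu>] by measurable
  define s where "s = nu_star \<nu> (eta TYPE('a) r)"
  have s: "s = Inf {ennreal a | a. 0 < a \<and> emeasure lebesgue {h. ennreal a < g h} \<le> ennreal r}"
  proof -
    have "{h. h \<noteq> 0 \<and> \<nu> h > a} = {h. ennreal a < g h}" if "0 < a" for a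
      using that nonneg by (auto simp: g_def ennreal_less_iff)
    then show ?thesis
      unfolding s_def nu_star_def measure_ball_eta_power[OF \<open>0 < r\<close>]
      by (intro arg_cong[of _ _ Inf]) auto
  qed
  have N: "nu_sharp \<nu> r = (\<integral>\<^sup>+ h \<in> {h. g h < s}. g h \<partial>lebesgue)"
    unfolding nu_sharp_def s_def by (intro nn_integral_cong) (auto simp: g_def indicator_def)
  show ?thesis
  proof (cases "s = 0")
    case False
    have "ennreal r < emeasure lebesgue {x \<in> space lebesgue. s' < g x}" if "0 < s'" "s' < s" for s'
    proof (rule ccontr)
      assume "\<not> ?thesis"
      moreover obtain a where a: "s' = ennreal a" "0 < a"
      proof (rule that)
        show "s' = ennreal (enn2real s')" "0 < enn2real s'"
          using \<open>0 < s'\<close> \<open>s' < s\<close> by (auto simp: less_top[symmetric] enn2real_positive_iff dest: less_le_trans[OF _ top_greatest])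
      qed
      ultimately have "s \<le> s'"
        unfolding s by (intro Inf_lower) auto
      with that show False by auto
    qed
    with False fin have "ennreal r \<le> emeasure lebesgue {x \<in> space lebesgue. s \<le> g x}"
      unfolding N by (intro emeasure_superlevel_ge) (auto simp: zero_less_iff_neq_zero)
    then show ?thesis
      unfolding N using D by (intro set_nn_integral_sublevel_le[where r="ennreal r"]) (auto intro: le_less_trans)
  qed (simp add: N)
qed

section \<open>Interaction of a set with a complement, by translation invariance\<close>

lemma nn_integral_lborel_reflect:
  fixes G :: "'a::euclidean_space \<Rightarrow> ennreal"
  assumes [measurable]: "G \<in> borel_measurable borel"
  shows "(\<integral>\<^sup>+ y. G (x - y) \<partial>lborel) = (\<integral>\<^sup>+ h. G h \<partial>lborel)"
proof -
  have eq: "lborel = distr lborel borel (\<lambda>y. x + (-1) *\<^sub>R y)"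
    using lborel_affine[of "-1" x] by (simp add: density_1)
  show ?thesis
    by (subst (2) eq, subst nn_integral_distr) auto
qed

lemma nn_integral_lborel_shift:
  fixes G :: "'a::euclidean_space \<Rightarrow> ennreal"
  assumes [measurable]: "G \<in> borel_measurable borel"
  shows "(\<integral>\<^sup>+ x. G (x - y) \<partial>lborel) = (\<integral>\<^sup>+ h. G h \<partial>lborel)"
proof -
  have eq: "lborel = distr lborel borel (\<lambda>x. - y + 1 *\<^sub>R x)"
    using lborel_affine[of 1 "- y"] by (simp add: density_1)
  show ?thesis
    by (subst (2) eq, subst nn_integral_distr) auto
qed

text \<open>The preimages of \<open>B\<close> under \<open>h \<mapsto> x - h\<close> and
  \<open>h \<mapsto> h + x\<close> have the measure of \<open>B\<close>, so \<open>c\<close> applies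
  to them. Both orientations are needed because \<open>G\<close> is not assumed to be even.\<close>

lemma nn_integral_kernel_complement_ge:
  fixes G :: "'a::euclidean_space \<Rightarrow> ennreal"
  assumes [measurable]: "G \<in> borel_measurable borel" "B \<in> sets borel"
    and c: "\<And>D. D \<in> sets borel \<Longrightarrow> emeasure lborel D = emeasure lborel B \<Longrightarrow>
              c \<le> (\<integral>\<^sup>+ h \<in> - D. G h \<partial>lborel)"
  shows "c \<le> (\<integral>\<^sup>+ y. indicator (- B) y * G (x - y) \<partial>lborel)"
    and "c \<le> (\<integral>\<^sup>+ y. indicator (- B) y * G (y - x) \<partial>lborel)"
proof -
  define D where "D = (\<lambda>h. x - h) -` B"
  have [measurable]: "D \<in> sets borel"
    unfolding D_def vimage_def by measurable
  have "emeasure lborel D = (\<integral>\<^sup>+ h. indicator D h \<partial>lborel)"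
    by simp
  also have "\<dots> = (\<integral>\<^sup>+ h. indicator B (x - h) \<partial>lborel)"
    by (intro nn_integral_cong) (auto simp: D_def indicator_def)
  also have "\<dots> = emeasure lborel B"
    by (subst nn_integral_lborel_reflect) auto
  finally have "c \<le> (\<integral>\<^sup>+ h \<in> - D. G h \<partial>lborel)"
    by (intro c) auto
  also have "\<dots> = (\<integral>\<^sup>+ y. G (x - y) * indicator (- D) (x - y) \<partial>lborel)"
    by (subst nn_integral_lborel_reflect[of "\<lambda>h. G h * indicator (- D) h"]) auto
  also have "\<dots> = (\<integral>\<^sup>+ y. indicator (- B) y * G (x - y) \<partial>lborel)"
    by (intro nn_integral_cong) (auto simp: D_def indicator_def)
  finally show "c \<le> (\<integral>\<^sup>+ y. indicator (- B) y * G (x - y) \<partial>lborel)" .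
next
  define D where "D = (\<lambda>h. h + x) -` B"
  have [measurable]: "D \<in> sets borel"
    unfolding D_def vimage_def by measurable
  have "emeasure lborel D = (\<integral>\<^sup>+ h. indicator D h \<partial>lborel)"
    by simp
  also have "\<dots> = (\<integral>\<^sup>+ h. indicator B (h - (- x)) \<partial>lborel)"
    by (intro nn_integral_cong) (auto simp: D_def indicator_def)
  also have "\<dots> = emeasure lborel B"
    by (subst nn_integral_lborel_shift) auto
  finally have "c \<le> (\<integral>\<^sup>+ h \<in> - D. G h \<partial>lborel)"
    by (intro c) auto
  also have "\<dots> = (\<integral>\<^sup>+ y. G (y - x) * indicator (- D) (y - x) \<partial>lborel)"
    by (subst nn_integral_lborel_shift[of "\<lambda>h. G h * indicator (- D) h"]) auto
  also have "\<dots> = (\<integral>\<^sup>+ y. indicator (- B) y * G (y - x) \<partial>lborel)"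
    by (intro nn_integral_cong) (auto simp: D_def indicator_def)
  finally show "c \<le> (\<integral>\<^sup>+ y. indicator (- B) y * G (y - x) \<partial>lborel)" .
qed

lemma nn_integral_kernel_rectangle_ge:
  fixes G :: "'a::euclidean_space \<Rightarrow> ennreal"
  assumes [measurable]: "G \<in> borel_measurable borel" "A \<in> sets borel" "B \<in> sets borel"
    and c: "\<And>D. D \<in> sets borel \<Longrightarrow> emeasure lborel D = emeasure lborel B \<Longrightarrow>
              c \<le> (\<integral>\<^sup>+ h \<in> - D. G h \<partial>lborel)"
  shows "emeasure lborel A * c
      \<le> (\<integral>\<^sup>+ x. \<integral>\<^sup>+ y. indicator A x * indicator (- B) y * G (x - y) \<partial>lborel \<partial>lborel)"
    and "emeasure lborel A * c
      \<le> (\<integral>\<^sup>+ x. \<integral>\<^sup>+ y. indicator A y * indicator (- B) x * G (x - y) \<partial>lborel \<partial>lborel)"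
proof -
  have A: "emeasure lborel A * c = (\<integral>\<^sup>+ x. indicator A x * c \<partial>lborel)"
    by (subst nn_integral_multc) auto
  also have "\<dots> \<le> (\<integral>\<^sup>+ x. indicator A x * (\<integral>\<^sup>+ y. indicator (- B) y * G (x - y) \<partial>lborel) \<partial>lborel)"
    by (intro nn_integral_mono mult_left_mono nn_integral_kernel_complement_ge(1) c) auto
  also have "\<dots> = (\<integral>\<^sup>+ x. \<integral>\<^sup>+ y. indicator A x * indicator (- B) y * G (x - y) \<partial>lborel \<partial>lborel)"
    by (subst nn_integral_cmult[symmetric]) (auto simp: mult.assoc)
  finally show "emeasure lborel A * c
      \<le> (\<integral>\<^sup>+ x. \<integral>\<^sup>+ y. indicator A x * indicator (- B) y * G (x - y) \<partial>lborel \<partial>lborel)" .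
  note A
  also have "(\<integral>\<^sup>+ x. indicator A x * c \<partial>lborel)
      \<le> (\<integral>\<^sup>+ x. indicator A x * (\<integral>\<^sup>+ y. indicator (- B) y * G (y - x) \<partial>lborel) \<partial>lborel)"
    by (intro nn_integral_mono mult_left_mono nn_integral_kernel_complement_ge(2) c) auto
  \<comment> \<open>The bound variables are renamed so that the kernel reads
    \<open>G (x - y)\<close> again; Tonelli's theorem then restores the order of
    integration.\<close>
  also have "\<dots> = (\<integral>\<^sup>+ y. \<integral>\<^sup>+ x. indicator A y * indicator (- B) x * G (x - y) \<partial>lborel \<partial>lborel)"
    by (subst nn_integral_cmult[symmetric]) (auto simp: mult.assoc)
  also have "\<dots> = (\<integral>\<^sup>+ x. \<integral>\<^sup>+ y. indicator A y * indicator (- B) x * G (x - y) \<partial>lborel \<partial>lborel)"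
    by (rule lborel_pair.Fubini') measurable
  finally show "emeasure lborel A * c
      \<le> (\<integral>\<^sup>+ x. \<integral>\<^sup>+ y. indicator A y * indicator (- B) x * G (x - y) \<partial>lborel \<partial>lborel)" .
qed

section \<open>Lower bound of the energy by a sum over levels\<close>

text \<open>Let \<open>m\<close> be the first level that separates \<open>b\<close> from
  \<open>a\<close>. The weights from \<open>m\<close> on form a geometric series of ratio
  \<open>q = t powr - p\<close>, whose sum times \<open>1 - q\<close> is at most its first term
  \<open>(T / t ^ Suc m) powr p\<close>. That term is at most \<open>(a - b) powr p\<close> because
  the gap between two consecutive levels is at least the lower one.\<close>

lemma geometric_layer_sum_le:
  fixes a b p t T :: real
  assumes p: "1 \<le> p" and t: "2 \<le> t" and T: "0 < T" and "b \<le> a"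
  shows "(1 - t powr - p) * (\<Sum>n<N. (T / t ^ Suc n) powr p * of_bool (T / t ^ n < a \<and> b \<le> T / t ^ Suc n))
     \<le> (a - b) powr p"
proof -
  define q where "q = t powr - p"
  define S where "S = {n. n < N \<and> T / t ^ n < a \<and> b \<le> T / t ^ Suc n}"
  have q: "0 < q" "q < 1"
    using t p by (auto simp: q_def intro: powr_less_one)
  have Tq: "(T / t ^ n) powr p = T powr p * q ^ n" for n
    using t T by (simp add: q_def powr_divide powr_minus_divide powr_realpow[symmetric] powr_powr mult.commute power_divide)
  have S: "(\<Sum>n<N. (T / t ^ Suc n) powr p * of_bool (T / t ^ n < a \<and> b \<le> T / t ^ Suc n))
      = (\<Sum>n\<in>S. T powr p * q ^ Suc n)" (is "?lhs = _")
    unfolding Tq[symmetric] by (rule sum.mono_neutral_cong_right) (auto simp: S_def)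
  show ?thesis
  proof (cases "S = {}")
    case True
    then show ?thesis unfolding S by simp
  next
    case False
    define m where "m = Min S"
    have fin: "finite S" by (auto simp: S_def)
    have m: "m \<in> S" using fin False by (simp add: m_def)
    have sub: "S \<subseteq> {m..<N}" using fin by (auto simp: m_def S_def intro!: Min_le)
    have "(\<Sum>n\<in>S. T powr p * q ^ Suc n) \<le> (\<Sum>n\<in>{m..<N}. T powr p * q ^ Suc n)"
      using sub q by (intro sum_mono2) auto
    then have "(1 - q) * ?lhs \<le> (1 - q) * (\<Sum>n\<in>{m..<N}. T powr p * q ^ Suc n)"
      unfolding S using q by (intro mult_left_mono) auto
    \<comment> \<open>The factor \<open>1 - q\<close> makes the geometric sum telescope.\<close>
    also have "\<dots> = - (T powr p * (\<Sum>n\<in>{m..<N}. q ^ Suc (Suc n) - q ^ Suc n))"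
      by (simp add: sum_distrib_left sum_negf[symmetric] algebra_simps)
    also have "\<dots> = - (T powr p * (q ^ Suc N - q ^ Suc m))"
      using m by (subst sum_Suc_diff'[where f="\<lambda>n. q ^ Suc n"]) (auto simp: S_def)
    also have "\<dots> \<le> T powr p * q ^ Suc m"
      using q by (simp add: algebra_simps)
    also have "\<dots> = (T / t ^ Suc m) powr p"
      by (simp only: Tq)
    also have "\<dots> \<le> (a - b) powr p"
    proof (rule powr_mono2)
      have bm: "b \<le> T / t ^ Suc m"
        using m unfolding S_def by blast
      \<comment> \<open>Here \<open>2 \<le> t\<close> enters: \<open>a\<close> exceeds twice the
        level that bounds \<open>b\<close>.\<close>
      have "2 * (T / t ^ Suc m) \<le> t * (T / t ^ Suc m)"
        using t T by (intro mult_right_mono) auto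
      also have "\<dots> = T / t ^ m"
        using t by simp
      also have "\<dots> < a" using m by (simp add: S_def)
      finally show "T / t ^ Suc m \<le> a - b"
        using bm by linarith
    qed (use p t T in auto)
    finally show ?thesis by (simp add: q_def)
  qed
qed

text \<open>The rectangle bounds for both orientations are weighted by \<open>k n\<close> and added,
  which gives the factor 2. Under the integral the weighted sum is controlled by
  \<open>geometric_layer_sum_le\<close>. The bound \<open>c n\<close> is left abstract so that it
  can be taken to be 0 at levels with a null superlevel set.\<close>

lemma energy_ge_layer_sum:
  fixes G :: "'a::euclidean_space \<Rightarrow> ennreal" and v :: "'a \<Rightarrow> real" and T :: real
  assumes p: "1 \<le> p" and t: "2 \<le> t" and T: "0 < T"
    and [measurable]: "G \<in> borel_measurable borel" "v \<in> borel_measurable borel"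
    and c: "\<And>n D. D \<in> sets borel \<Longrightarrow> emeasure lborel D = emeasure lborel {x. T / t ^ Suc n < v x} \<Longrightarrow>
              c n \<le> (\<integral>\<^sup>+ h \<in> - D. G h \<partial>lborel)"
  shows "(\<Sum>n<N. ennreal (2 * (1 - t powr - p) * (T / t ^ Suc n) powr p) *
             (emeasure lborel {x. T / t ^ n < v x} * c n))
     \<le> (\<integral>\<^sup>+ x. \<integral>\<^sup>+ y. ennreal (\<bar>v x - v y\<bar> powr p) * G (x - y) \<partial>lborel \<partial>lborel)"
proof -
  define A where "A n = {x. T / t ^ n < v x}" for n
  have [measurable]: "A n \<in> sets borel" for n
    unfolding A_def by measurable
  define k where "k n = (1 - t powr - p) * (T / t ^ Suc n) powr p" for n
  have k: "0 \<le> k n" for n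
    unfolding k_def using t p by (auto simp: powr_minus_divide intro!: mult_nonneg_nonneg ge_one_powr_ge_zero)
  \<comment> \<open>For a fixed pair only one orientation can occur, since the levels decrease and
    the larger value must lie above the higher level.\<close>
  have pt: "(\<Sum>n<N. k n * (of_bool (T / t ^ n < a \<and> b \<le> T / t ^ Suc n) + of_bool (T / t ^ n < b \<and> a \<le> T / t ^ Suc n)))
      \<le> \<bar>a - b\<bar> powr p" for a b
  proof -
    have dec: "T / t ^ Suc n \<le> T / t ^ n" for n
      using t T by (intro divide_left_mono power_increasing mult_pos_pos) auto
    have *: "(\<Sum>n<N. k n * (of_bool (T / t ^ n < a \<and> b \<le> T / t ^ Suc n) + of_bool (T / t ^ n < b \<and> a \<le> T / t ^ Suc n)))
      \<le> (a - b) powr p" if "b \<le> a" for a b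
    proof -
      have z: "\<not> (T / t ^ n < b \<and> a \<le> T / t ^ Suc n)" for n
        using dec[of n] that by linarith
      have "(\<Sum>n<N. k n * (of_bool (T / t ^ n < a \<and> b \<le> T / t ^ Suc n) + of_bool (T / t ^ n < b \<and> a \<le> T / t ^ Suc n)))
        = (1 - t powr - p) * (\<Sum>n<N. (T / t ^ Suc n) powr p * of_bool (T / t ^ n < a \<and> b \<le> T / t ^ Suc n))"
        unfolding sum_distrib_left k_def by (intro sum.cong refl) (simp only: z of_bool_eq add_0_right mult.assoc)
      also have "\<dots> \<le> (a - b) powr p"
        by (rule geometric_layer_sum_le) fact+
      finally show ?thesis .
    qed
    show ?thesis
    proof (cases "b \<le> a")
      case True
      then show ?thesis using *[OF True] by simp
    next
      case False
      then show ?thesis using *[of a b] by (simp only: add.commute abs_minus_commute[of a b]) simp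
    qed
  qed
  let ?J = "\<lambda>n x y. indicator (A n) x * indicator (- A (Suc n)) y * G (x - y)"
  let ?J' = "\<lambda>n x y. indicator (A n) y * indicator (- A (Suc n)) x * G (x - y)"
  have "(\<Sum>n<N. ennreal (2 * (1 - t powr - p) * (T / t ^ Suc n) powr p) * (emeasure lborel (A n) * c n))
     = (\<Sum>n<N. ennreal (k n) * (emeasure lborel (A n) * c n + emeasure lborel (A n) * c n))"
  proof (rule sum.cong)
    fix n
    have "ennreal (2 * (1 - t powr - p) * (T / t ^ Suc n) powr p) = ennreal (k n) + ennreal (k n)"
      using k[of n] by (subst ennreal_plus[symmetric]) (auto simp: k_def algebra_simps)
    then show "ennreal (2 * (1 - t powr - p) * (T / t ^ Suc n) powr p) * (emeasure lborel (A n) * c n)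
      = ennreal (k n) * (emeasure lborel (A n) * c n + emeasure lborel (A n) * c n)"
      by (simp only: distrib_left distrib_right)
  qed simp
  also have "\<dots> \<le> (\<Sum>n<N. ennreal (k n) * ((\<integral>\<^sup>+ x. \<integral>\<^sup>+ y. ?J n x y \<partial>lborel \<partial>lborel) +
     (\<integral>\<^sup>+ x. \<integral>\<^sup>+ y. ?J' n x y \<partial>lborel \<partial>lborel)))"
    using c unfolding A_def[symmetric]
    by (intro sum_mono mult_left_mono add_mono nn_integral_kernel_rectangle_ge) auto
  also have "\<dots> = (\<integral>\<^sup>+ x. \<integral>\<^sup>+ y. (\<Sum>n<N. ennreal (k n) * (?J n x y + ?J' n x y)) \<partial>lborel \<partial>lborel)"
    by (simp add: nn_integral_sum nn_integral_cmult nn_integral_add)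
  also have "\<dots> \<le> (\<integral>\<^sup>+ x. \<integral>\<^sup>+ y. ennreal (\<bar>v x - v y\<bar> powr p) * G (x - y) \<partial>lborel \<partial>lborel)"
  proof (intro nn_integral_mono)
    fix x y
    have "(\<Sum>n<N. ennreal (k n) * (?J n x y + ?J' n x y)) =
      (\<Sum>n<N. ennreal (k n * (of_bool (T / t ^ n < v x \<and> v y \<le> T / t ^ Suc n) + of_bool (T / t ^ n < v y \<and> v x \<le> T / t ^ Suc n))))
         * G (x - y)"
      unfolding sum_distrib_right
    proof (intro sum.cong refl)
      fix n
      have "?J n x y + ?J' n x y = ennreal (of_bool (T / t ^ n < v x \<and> v y \<le> T / t ^ Suc n) + of_bool (T / t ^ n < v y \<and> v x \<le> T / t ^ Suc n)) * G (x - y)"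
        by (auto simp: A_def indicator_def ennreal_plus[symmetric] distrib_right not_less mult_2 simp del: ennreal_plus power_Suc)
      then show "ennreal (k n) * (?J n x y + ?J' n x y) = ennreal (k n * (of_bool (T / t ^ n < v x \<and> v y \<le> T / t ^ Suc n) + of_bool (T / t ^ n < v y \<and> v x \<le> T / t ^ Suc n))) * G (x - y)"
        using k[of n] by (subst ennreal_mult) (auto simp: mult.assoc simp del: power_Suc)
    qed
    also have "\<dots> \<le> ennreal (\<bar>v x - v y\<bar> powr p) * G (x - y)"
      using k pt[of "v x" "v y"] by (subst sum_ennreal) (auto intro!: mult_right_mono ennreal_leI)
    finally show "(\<Sum>n<N. ennreal (k n) * (?J n x y + ?J' n x y)) \<le> ennreal (\<bar>v x - v y\<bar> powr p) * G (x - y)" .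
  qed
  finally show ?thesis
    by (simp add: A_def)
qed

text \<open>Real-valued versions: \<open>f\<close> is \<open>\<phi>\<close> extended by \<open>0\<close> to the negative axis, \<open>W\<close> is \<open>w\<close> and \<open>N\<close> is \<open>\<nu>\<^sup>#\<close>.\<close>

locale growth_profile =
  fixes p \<theta> :: real and f W N :: "real \<Rightarrow> real"
  assumes p: "1 \<le> p" and \<theta>: "0 < \<theta>"
    and f_nonpos: "x \<le> 0 \<Longrightarrow> f x = 0"
    and f_pos: "0 < x \<Longrightarrow> 0 < f x"
    and convex: "convex_on {0..} (\<lambda>y. f (y powr (1 / p)))"
    and W_0: "W 0 = 0"
    and W_pos: "0 < r \<Longrightarrow> 0 < W r"
    and f_W: "0 < r \<Longrightarrow> f (1 / W r) = 1 / r"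
    and W_powr: "0 < r \<Longrightarrow> W r powr p = r * N r"
    and submult: "0 \<le> a \<Longrightarrow> a \<le> b \<Longrightarrow> 0 < b \<Longrightarrow> f (\<theta> * (a / b)) \<le> f a / f b"
begin

section \<open>Growth of \<open>f\<close> and monotonicity of \<open>W\<close>\<close>

lemma f_nonneg: "0 \<le> f x"
  using f_pos[of x] f_nonpos[of x] by (cases "x \<le> 0") auto

text \<open>This is convexity of \<open>y \<mapsto> f (y powr (1 / p))\<close> on the segment from 0
  to \<open>x powr p\<close>, together with \<open>f 0 = 0\<close>.\<close>

lemma f_scale_le:
  assumes "0 \<le> c" "c \<le> 1" "0 \<le> x"
  shows "f (c * x) \<le> c powr p * f x"
proof -
  have le1: "c powr p \<le> 1"
    using assms p powr_le1[of p c] by auto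
  have "f ((c powr p * x powr p + (1 - c powr p) * 0) powr (1 / p))
      \<le> c powr p * f ((x powr p) powr (1 / p)) + (1 - c powr p) * f (0 powr (1 / p))"
    using convex_onD[OF convex, of "1 - c powr p" "x powr p" 0] le1 assms by (simp add: algebra_simps)
  moreover have "(c powr p * x powr p) powr (1 / p) = c * x" "(x powr p) powr (1 / p) = x"
    using assms p by (auto simp: powr_mult[symmetric] powr_powr)
  ultimately show ?thesis
    by (simp add: f_nonpos)
qed

lemma mono_f: "mono f"
proof (rule monoI)
  fix x y :: real assume "x \<le> y"
  show "f x \<le> f y"
  proof (cases "x \<le> 0")
    case True
    then show ?thesis by (simp add: f_nonpos f_nonneg)
  next
    case False
    then have "f x = f (x / y * y)" using \<open>x \<le> y\<close> by simp
    also have "\<dots> \<le> (x / y) powr p * f y"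
      using False \<open>x \<le> y\<close> by (intro f_scale_le) auto
    also have "\<dots> \<le> 1 * f y"
      using False \<open>x \<le> y\<close> p f_nonneg by (intro mult_right_mono powr_le1) auto
    finally show ?thesis by simp
  qed
qed

text \<open>Monotonicity is inherited from \<open>f\<close> through
  \<open>f (1 / W r) = 1 / r\<close>: a decrease of \<open>W\<close> from \<open>a\<close> to
  \<open>b\<close> would give \<open>1 / a \<le> 1 / b\<close>, hence \<open>a = b\<close>.\<close>

lemma W_mono:
  assumes "0 \<le> a" "a \<le> b"
  shows "W a \<le> W b"
proof (rule ccontr)
  assume neg: "\<not> W a \<le> W b"
  have "0 < a"
    using neg assms W_0 W_pos[of b] by (cases "a = 0"; cases "b = 0") auto
  then have "0 < b" using assms by simp
  have "1 / a = f (1 / W a)" using f_W[OF \<open>0 < a\<close>] by simp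
  also have "\<dots> \<le> f (1 / W b)"
    using neg W_pos[OF \<open>0 < b\<close>] by (intro monoD[OF mono_f] divide_left_mono) auto
  also have "\<dots> = 1 / b" using f_W[OF \<open>0 < b\<close>] by simp
  finally have "a = b"
    using \<open>0 < a\<close> \<open>0 < b\<close> assms by (auto simp: field_simps)
  then show False using neg by simp
qed

section \<open>Sums over geometric levels and Jensen's inequality\<close>

lemma summable_levels:
  fixes T t :: real
  assumes "2 \<le> t" "0 < T" and b: "\<And>n. 0 \<le> b n" "\<And>n. b n \<le> B"
  shows "summable (\<lambda>n. (T / t ^ n) powr p * W (b n) powr p)"
proof (rule summable_comparison_test')
  let ?q = "t powr - p"
  have q: "?q < 1" using assms(1) p by (intro powr_less_one) auto
  show "summable (\<lambda>n. T powr p * W B powr p * ?q ^ n)"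
    using q by (intro summable_mult summable_geometric) auto
  fix n
  have nn: "0 \<le> W (b n)" using W_pos[of "b n"] W_0 b(1)[of n] by (cases "b n = 0") auto
  have "(T / t ^ n) powr p = T powr p * ?q ^ n"
    using assms(1,2) by (simp add: powr_divide powr_minus_divide powr_realpow[symmetric] powr_powr mult.commute power_divide)
  moreover have "W (b n) powr p \<le> W B powr p"
    using p nn by (intro powr_mono2 W_mono b) auto
  ultimately show "norm ((T / t ^ n) powr p * W (b n) powr p) \<le> T powr p * W B powr p * ?q ^ n"
    by (simp add: mult_left_mono mult_right_mono mult.assoc mult.commute[of "?q ^ n"])
qed

text \<open>Put \<open>x = \<theta> * (W (b n) / W (b (Suc n)))\<close>. Then
  \<open>z (Suc n) * x powr p = y0 * z n\<close>, and the sums of \<open>z n\<close> and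
  \<open>z (Suc n)\<close> agree because \<open>z 0 = 0\<close>. So the mean of
  \<open>x powr p\<close> with weights \<open>z (Suc n)\<close> is exactly \<open>y0\<close>, and
  Jensen's inequality yields the factor \<open>g y0 = f (\<theta> / t)\<close>.\<close>

lemma level_sum_lower_bound:
  fixes T t K :: real and b :: "nat \<Rightarrow> real"
  assumes t: "2 \<le> t" and T: "0 < T" and b0: "b 0 = 0" and b: "incseq b" "\<And>n. b n \<le> B"
    and K: "\<And>m. (\<Sum>n<m. (T / t ^ Suc n) powr p * (b n * N (b (Suc n)))) \<le> K"
  shows "f (\<theta> / t) * (\<Sum>n. (T / t ^ Suc n) powr p * W (b (Suc n)) powr p) \<le> K"
proof -
  have bnn: "0 \<le> b n" for n
    using incseqD[OF b(1), of 0 n] b0 by simp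
  have bS: "b n \<le> b (Suc n)" for n
    using incseqD[OF b(1), of n "Suc n"] by simp
  define g where "g y = f (y powr (1 / p))" for y
  define y0 where "y0 = (\<theta> / t) powr p"
  have y0: "0 < y0" using \<theta> t by (simp add: y0_def)
  have gy0: "g y0 = f (\<theta> / t)"
    using \<theta> t p by (simp add: g_def y0_def powr_powr)
  \<comment> \<open>Jensen's inequality in the form of a supporting line at \<open>y0\<close>, which can be summed term by term\<close>
  obtain c where c: "g y0 + c * (y - y0) \<le> g y" if "0 \<le> y" for y
    using convex_le_Inf_differential[OF convex, of y0] y0
    unfolding g_def by auto
  define z where "z n = (T / t ^ n) powr p * W (b n) powr p" for n
  have sz: "summable z"
    unfolding z_def using summable_levels[OF t T bnn b(2)] .
  have z0: "z 0 = 0" using W_0 b0 p by (simp add: z_def)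
  have sumz: "suminf z = (\<Sum>n. z (Suc n))"
    using suminf_split_head[OF sz] z0 by simp
  \<comment> \<open>This is \<open>z (Suc n)\<close> times the supporting line at
    \<open>x powr p\<close>, written without a division by \<open>W (b (Suc n))\<close>, which may
    vanish.\<close>
  define l where "l n = z (Suc n) * (g y0 - c * y0) + c * y0 * z n" for n
  have le: "l n \<le> (T / t ^ Suc n) powr p * (b n * N (b (Suc n)))" for n
  proof (cases "b (Suc n) = 0")
    case True
    then have "b n = 0" using bS[of n] bnn[of n] by simp
    then show ?thesis using True W_0 p by (simp add: l_def z_def)
  next
    case False
    then have bp: "0 < b (Suc n)" using bnn[of "Suc n"] by simp
    note Wp = W_pos[OF bp]
    define x where "x = \<theta> * (W (b n) / W (b (Suc n)))"
    have Wn: "0 \<le> W (b n)" using W_pos[of "b n"] W_0 bnn[of n] by (cases "b n = 0") auto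
    have x: "0 \<le> x" using Wn Wp \<theta> by (simp add: x_def)
    have "T / t ^ Suc n = T / t ^ n / t" by simp
    then have "y0 * z n = z (Suc n) * x powr p"
      using Wn Wp \<theta> t T unfolding z_def y0_def x_def
      by (simp add: powr_divide powr_mult ac_simps del: power_Suc)
    then have "l n = z (Suc n) * (g y0 + c * (x powr p - y0))"
      by (simp add: l_def algebra_simps)
    also have "\<dots> \<le> z (Suc n) * g (x powr p)"
      by (intro mult_left_mono c) (auto simp: z_def)
    also have "g (x powr p) = f x"
      using x p by (simp add: g_def powr_powr)
    also have "z (Suc n) * f x \<le> z (Suc n) * (b n / b (Suc n))"
    proof (rule mult_left_mono)
      show "f x \<le> b n / b (Suc n)"
      proof (cases "b n = 0")
        case True
        then show ?thesis by (simp add: x_def W_0 f_nonpos)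
      next
        case False
        then have bn: "0 < b n" using bnn[of n] by simp
        \<comment> \<open>The condition on \<open>f\<close> is applied to the reciprocals of
          \<open>W\<close>, where \<open>f_W\<close> turns the quotient of values into
          \<open>b n / b (Suc n)\<close>.\<close>
        have "f (\<theta> * ((1 / W (b (Suc n))) / (1 / W (b n)))) \<le> f (1 / W (b (Suc n))) / f (1 / W (b n))"
          using Wp W_pos[OF bn] W_mono[OF bnn bS, of n] by (intro submult divide_left_mono) auto
        then show ?thesis
          by (simp add: x_def f_W bp bn)
      qed
    qed (simp add: z_def)
    also have "\<dots> = (T / t ^ Suc n) powr p * (b n * N (b (Suc n)))"
      using bp by (simp add: z_def W_powr)
    finally show ?thesis .
  qed
  have "(\<lambda>n. z (Suc n) * (g y0 - c * y0) + c * y0 * z n) sums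
      ((\<Sum>n. z (Suc n)) * (g y0 - c * y0) + c * y0 * suminf z)"
    using sz by (intro sums_add sums_mult sums_mult2 summable_sums) (auto simp: summable_Suc_iff)
  \<comment> \<open>The terms with the slope \<open>c\<close> cancel, since both sums of
    \<open>z\<close> are equal.\<close>
  then have "l sums (f (\<theta> / t) * (\<Sum>n. z (Suc n)))"
    unfolding sumz gy0[symmetric] l_def[symmetric] by (simp add: algebra_simps)
  moreover have "(\<Sum>n<m. l n) \<le> K" for m
    using sum_mono[of "{..<m}", OF le] K[of m] by (rule order.trans)
  ultimately have "f (\<theta> / t) * (\<Sum>n. z (Suc n)) \<le> K"
    unfolding sums_def by (intro LIMSEQ_le_const2) auto
  then show ?thesis by (simp add: z_def)
qed

text \<open>Suppose that the right-hand side is less than 1. Where \<open>b (Suc n) > 0\<close>,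
  \<open>x = T / t ^ n * W (b (Suc n))\<close> then satisfies \<open>x \<le> 1\<close>, so
  \<open>f_scale_le\<close> and \<open>f_W\<close> give
  \<open>f (T / t ^ n) * b (Suc n) \<le> x powr p\<close>. Summation over the levels bounds the
  modular of \<open>v\<close> by a number less than 1.\<close>

lemma modular_gt_1_imp_level_sum_ge:
  fixes M :: "'b measure" and v :: "'b \<Rightarrow> real" and T t :: real
  defines "b \<equiv> \<lambda>n. measure M {x \<in> space M. T / t ^ n < v x}"
  assumes t: "2 \<le> t" and T: "0 < T"
    and v[measurable]: "v \<in> borel_measurable M" and vT: "\<And>x. v x \<le> T"
    and fin: "emeasure M {x \<in> space M. 0 < v x} < \<infinity>"
    and gt: "1 < (\<integral>\<^sup>+ x. ennreal (f (v x)) \<partial>M)"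
  shows "1 \<le> t powr p * (\<Sum>n. (T / t ^ Suc n) powr p * W (b (Suc n)) powr p)"
proof (rule ccontr)
  define z where "z n = (T / t ^ Suc n) powr p * W (b (Suc n)) powr p" for n
  have zn: "0 \<le> z n" for n by (simp add: z_def)
  define A where "A n = {x \<in> space M. T / t ^ n < v x}" for n
  have [measurable]: "A n \<in> sets M" for n unfolding A_def by measurable
  have sub: "A n \<subseteq> {x \<in> space M. 0 < v x}" for n
    using t T by (auto simp: A_def intro: le_less_trans[rotated])
  have finA: "emeasure M (A n) < \<infinity>" for n
    using emeasure_mono[OF sub[of n], of M] fin by (auto intro: le_less_trans)
  have bA: "emeasure M (A n) = ennreal (b n)" for n
    using finA[of n] by (simp add: b_def A_def emeasure_eq_ennreal_measure less_top)
  have bB: "b n \<le> measure M {x \<in> space M. 0 < v x}" for n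
    unfolding b_def A_def[symmetric]
    by (intro measure_mono_fmeasurable sub fmeasurableI) (use fin in auto)
  have sz: "summable z"
    unfolding z_def summable_Suc_iff[of "\<lambda>n. (T / t ^ n) powr p * W (b n) powr p"]
    by (rule summable_levels[OF t T _ bB]) (auto simp: b_def)
  assume "\<not> ?thesis"
  then have lt: "t powr p * (\<Sum>n. z n) < 1" by (simp add: z_def)
  have le: "f (T / t ^ n) * b (Suc n) \<le> t powr p * z n" for n
  proof (cases "b (Suc n) = 0")
    case True
    then show ?thesis by (simp add: z_def)
  next
    case False
    then have bp: "0 < b (Suc n)" by (simp add: b_def zero_less_measure_iff)
    note Wp = W_pos[OF bp]
    define x where "x = T / t ^ n * W (b (Suc n))"
    have x0: "0 \<le> x" using T t Wp by (simp add: x_def)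
    have xp: "x powr p = t powr p * z n"
      using T t Wp by (simp add: x_def z_def powr_mult powr_divide)
    \<comment> \<open>A single term is at most the whole sum; this is what makes
      \<open>x \<le> 1\<close>, the condition for \<open>f_scale_le\<close>.\<close>
    also have "\<dots> \<le> t powr p * (\<Sum>n. z n)"
    proof (intro mult_left_mono)
      show "z n \<le> suminf z"
        using sum_le_suminf[OF sz, of "{n}"] by (simp add: z_def[abs_def])
    qed simp
    finally have "x powr p \<le> 1" using lt by simp
    then have "x \<le> 1"
    proof (rule contrapos_pp)
      assume "\<not> x \<le> 1"
      then have "1 powr p < x powr p" using p by (intro powr_less_mono2) auto
      then show "\<not> x powr p \<le> 1" by simp
    qed
    have "f (T / t ^ n) = f (x * (1 / W (b (Suc n))))"
      using Wp by (simp add: x_def)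
    also have "\<dots> \<le> x powr p * f (1 / W (b (Suc n)))"
      using Wp x0 \<open>x \<le> 1\<close> by (intro f_scale_le) auto
    finally show ?thesis
      using bp f_W[OF bp] xp by (simp add: field_simps)
  qed
  have "(\<integral>\<^sup>+ x. ennreal (f (v x)) \<partial>M) \<le> (\<integral>\<^sup>+ x. (\<Sum>n. ennreal (f (T / t ^ n)) * indicator (A (Suc n)) x) \<partial>M)"
  proof (rule nn_integral_mono)
    fix x assume x: "x \<in> space M"
    show "ennreal (f (v x)) \<le> (\<Sum>n. ennreal (f (T / t ^ n)) * indicator (A (Suc n)) x)"
    proof (cases "0 < v x")
      case True
      have "\<exists>n. T / t ^ Suc n < v x"
      proof -
        obtain n where "T / v x < t ^ n" using real_arch_pow[of t "T / v x"] t by auto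
        also have "\<dots> \<le> t ^ Suc n" using t by (intro power_increasing) auto
        finally show ?thesis using True t by (auto simp: field_simps intro!: exI[of _ n])
      qed
      \<comment> \<open>At the first level below \<open>v x\<close> one has
        \<open>v x \<le> T / t ^ n\<close>. The sets \<open>A (Suc k)\<close> are nested rather than
        disjoint, so the series overcounts, which is harmless for an upper bound.\<close>
      then obtain n where n: "T / t ^ Suc n < v x" and min: "\<And>k. k < n \<Longrightarrow> \<not> T / t ^ Suc k < v x"
        using exists_least_iff[of "\<lambda>n. T / t ^ Suc n < v x"] by auto
      have "v x \<le> T / t ^ n"
        using min[of "n - 1"] vT[of x] by (cases n) auto
      then have "ennreal (f (v x)) \<le> (\<Sum>k\<in>{n}. ennreal (f (T / t ^ k)) * indicator (A (Suc k)) x)"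
        using n x by (auto simp: A_def intro!: ennreal_leI monoD[OF mono_f])
      also have "\<dots> \<le> (\<Sum>k. ennreal (f (T / t ^ k)) * indicator (A (Suc k)) x)"
        by (intro sum_le_suminf) auto
      finally show ?thesis .
    qed (simp add: f_nonpos)
  qed
  also have "\<dots> = (\<Sum>n. ennreal (f (T / t ^ n) * b (Suc n)))"
    by (subst nn_integral_suminf) (auto simp: nn_integral_cmult bA ennreal_mult f_nonneg b_def)
  also have "\<dots> \<le> (\<Sum>n. ennreal (t powr p * z n))"
    by (intro suminf_le ennreal_leI le) auto
  also have "\<dots> = ennreal (t powr p * (\<Sum>n. z n))"
    using sz zn by (subst suminf_ennreal2) (auto simp: suminf_mult intro!: summable_mult)
  also have "\<dots> < 1"
    using lt by simp
  finally show False using gt by simp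
qed

section \<open>From the energy to the modular\<close>

lemma energy_lower_bound:
  fixes G :: "'a::euclidean_space \<Rightarrow> ennreal" and v :: "'a \<Rightarrow> real" and T t :: real
  assumes t: "2 \<le> t" and T: "0 < T"
    and [measurable]: "G \<in> borel_measurable borel" "v \<in> borel_measurable borel"
    and kernel: "\<And>r D. 0 < r \<Longrightarrow> D \<in> sets borel \<Longrightarrow> emeasure lborel D = ennreal r \<Longrightarrow>
              ennreal (N r) \<le> (\<integral>\<^sup>+ h \<in> - D. G h \<partial>lborel)"
    and vT: "\<And>x. v x \<le> T" and fin: "emeasure lborel {x. 0 < v x} < \<infinity>"
    and gt: "1 < (\<integral>\<^sup>+ x. ennreal (f (v x)) \<partial>lborel)"
  shows "ennreal (2 * (1 - t powr - p) * f (\<theta> / t) / t powr p)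
     \<le> (\<integral>\<^sup>+ x. \<integral>\<^sup>+ y. ennreal (\<bar>v x - v y\<bar> powr p) * G (x - y) \<partial>lborel \<partial>lborel)" (is "_ \<le> ?E")
proof (cases "?E = \<infinity>")
  case False
  then obtain e where e: "?E = ennreal e" "0 \<le> e"
    by (cases ?E) auto
  define b where "b n = measure lborel {x. T / t ^ n < v x}" for n
  have fin': "emeasure lborel {x. T / t ^ n < v x} < \<infinity>" for n
  proof -
    have "emeasure lborel {x. T / t ^ n < v x} \<le> emeasure lborel {x. 0 < v x}"
      using t T by (intro emeasure_mono) (auto intro: le_less_trans[rotated])
    then show ?thesis using fin by (rule le_less_trans)
  qed
  have bA: "emeasure lborel {x. T / t ^ n < v x} = ennreal (b n)" for n
    using fin'[of n] by (simp add: b_def emeasure_eq_ennreal_measure less_top)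
  have b0: "b 0 = 0"
    using vT by (simp add: b_def not_less[symmetric])
  have b_inc: "incseq b"
  proof (rule incseq_SucI)
    fix n
    have "T / t ^ Suc n \<le> T / t ^ n"
      using t T by (intro divide_left_mono power_increasing mult_pos_pos) auto
    then show "b n \<le> b (Suc n)"
      unfolding b_def using fin'[of "Suc n"]
      by (intro measure_mono_fmeasurable fmeasurableI) auto
  qed
  have bB: "b n \<le> measure lborel {x. 0 < v x}" for n
    unfolding b_def using t T fin
    by (intro measure_mono_fmeasurable fmeasurableI) (auto intro: le_less_trans[rotated])
  have bnn: "0 \<le> b n" for n by (simp add: b_def)
  have N_nonneg: "0 \<le> N r" if "0 < r" for r
    using W_powr[OF that] that by (metis powr_ge_zero zero_le_mult_iff not_less)
  \<comment> \<open>The hypothesis on the kernel concerns positive \<open>r\<close> only. If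
    \<open>b (Suc n) = 0\<close>, then \<open>b n = 0\<close> as well, so the value 0 loses
    nothing.\<close>
  define c where "c n = (if b (Suc n) = 0 then 0 else ennreal (N (b (Suc n))))" for n
  define q where "q = t powr - p"
  have q: "q < 1" unfolding q_def using t p by (intro powr_less_one) auto
  have "(\<Sum>n<m. (T / t ^ Suc n) powr p * (b n * N (b (Suc n)))) \<le> e / (2 * (1 - q))" for m
  proof -
    have nn: "0 \<le> b n * N (b (Suc n))" for n
      using bnn[of n] bnn[of "Suc n"] incseqD[OF b_inc, of n "Suc n"] N_nonneg[of "b (Suc n)"]
      by (cases "b (Suc n) = 0") auto
    have bc: "ennreal (b n) * c n = ennreal (b n * N (b (Suc n)))" for n
      using bnn[of n] bnn[of "Suc n"] incseqD[OF b_inc, of n "Suc n"]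
      by (cases "b (Suc n) = 0") (auto simp: c_def ennreal_mult')
    have "(\<Sum>n<m. ennreal (2 * (1 - q) * (T / t ^ Suc n) powr p) * (ennreal (b n) * c n)) \<le> ?E"
      unfolding bA[symmetric] q_def
    proof (rule energy_ge_layer_sum)
      fix n and D :: "'a set"
      assume "D \<in> sets borel" "emeasure lborel D = emeasure lborel {x. T / t ^ Suc n < v x}"
      then show "c n \<le> (\<integral>\<^sup>+ h \<in> - D. G h \<partial>lborel)"
        using kernel[of "b (Suc n)" D] bnn[of "Suc n"] unfolding bA c_def by (cases "b (Suc n) = 0") auto
    qed (use p t T in auto)
    also have "(\<Sum>n<m. ennreal (2 * (1 - q) * (T / t ^ Suc n) powr p) * (ennreal (b n) * c n))
      = (\<Sum>n<m. ennreal (2 * (1 - q) * (T / t ^ Suc n) powr p * (b n * N (b (Suc n)))))"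
      using q nn unfolding bc by (intro sum.cong refl ennreal_mult[symmetric]) auto
    also have "\<dots> = ennreal (\<Sum>n<m. 2 * (1 - q) * (T / t ^ Suc n) powr p * (b n * N (b (Suc n))))"
      using q by (intro sum_ennreal mult_nonneg_nonneg[OF _ nn]) auto
    finally have "(\<Sum>n<m. 2 * (1 - q) * (T / t ^ Suc n) powr p * (b n * N (b (Suc n)))) \<le> e"
      using e by simp
    then have "2 * (1 - q) * (\<Sum>n<m. (T / t ^ Suc n) powr p * (b n * N (b (Suc n)))) \<le> e"
      by (simp add: sum_distrib_left mult.assoc)
    then show ?thesis
      using q by (simp add: pos_le_divide_eq mult.commute)
  qed
  from level_sum_lower_bound[OF t T b0 b_inc bB this]
  have 1: "f (\<theta> / t) * (\<Sum>n. (T / t ^ Suc n) powr p * W (b (Suc n)) powr p) \<le> e / (2 * (1 - q))" .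
  have 2: "1 \<le> t powr p * (\<Sum>n. (T / t ^ Suc n) powr p * W (b (Suc n)) powr p)"
    using modular_gt_1_imp_level_sum_ge[OF t T, where M=lborel and v=v] vT fin gt by (simp add: b_def)
  define S where "S = (\<Sum>n. (T / t ^ Suc n) powr p * W (b (Suc n)) powr p)"
  have "2 * (1 - q) * f (\<theta> / t) / t powr p = 2 * (1 - q) * (f (\<theta> / t) * (1 / t powr p))"
    by simp
  also have "\<dots> \<le> 2 * (1 - q) * (f (\<theta> / t) * S)"
  proof (intro mult_left_mono)
    show "1 / t powr p \<le> S"
      using 2 t unfolding S_def[symmetric] by (simp add: pos_divide_le_eq mult.commute)
  qed (use q f_nonneg in auto)
  also have "\<dots> \<le> e"
    using q 1 unfolding S_def[symmetric] by (simp add: pos_le_divide_eq mult.commute)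
  finally show ?thesis
    unfolding e q_def by (rule ennreal_leI)
qed simp

text \<open>Truncations \<open>v n\<close> of \<open>\<bar>u\<bar> / k\<close> have energy at most
  \<open>e / k powr p < \<kappa>\<close>, so \<open>energy_lower_bound\<close> excludes a modular
  greater than 1. Fatou's lemma passes this to \<open>u\<close>.\<close>

lemma modular_le_1:
  fixes G :: "'a::euclidean_space \<Rightarrow> ennreal" and u :: "'a \<Rightarrow> real" and e t l :: real
  defines "\<kappa> \<equiv> 2 * (1 - t powr - p) * f (\<theta> / t) / t powr p"
  assumes t: "2 \<le> t"
    and [measurable]: "G \<in> borel_measurable borel" "u \<in> borel_measurable borel"
    and kernel: "\<And>r D. 0 < r \<Longrightarrow> D \<in> sets borel \<Longrightarrow> emeasure lborel D = ennreal r \<Longrightarrow>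
              ennreal (N r) \<le> (\<integral>\<^sup>+ h \<in> - D. G h \<partial>lborel)"
    and fin: "\<And>s. 0 < s \<Longrightarrow> emeasure lborel {x. s < \<bar>u x\<bar>} < \<infinity>"
    and e: "(\<integral>\<^sup>+ x. \<integral>\<^sup>+ y. ennreal (\<bar>u x - u y\<bar> powr p) * G (x - y) \<partial>lborel \<partial>lborel) = ennreal e" "0 \<le> e"
    and l: "(e / \<kappa>) powr (1 / p) < l"
  shows "(\<integral>\<^sup>+ x. ennreal (f (\<bar>u x\<bar> / l)) \<partial>lborel) \<le> 1"
proof -
  have [measurable]: "f \<in> borel_measurable borel"
    by (rule borel_measurable_mono[OF mono_f])
  have \<kappa>: "0 < \<kappa>"
    unfolding \<kappa>_def using t p \<theta> f_pos powr_less_one[of t "- p"] by simp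
  \<comment> \<open>Both strict inequalities around \<open>k\<close> matter: the lower one gives
    \<open>e / k powr p < \<kappa>\<close>, and \<open>k < l\<close> leaves room for
    \<open>\<bar>u x\<bar> / l \<le> v n x\<close> eventually, so that monotonicity of
    \<open>f\<close> suffices in the limit.\<close>
  define k where "k = ((e / \<kappa>) powr (1 / p) + l) / 2"
  have k: "0 < k" "(e / \<kappa>) powr (1 / p) < k" "k < l"
  proof -
    have "0 < (a + l) / 2 \<and> a < (a + l) / 2 \<and> (a + l) / 2 < l" if "0 \<le> a" "a < l" for a
      using that by auto
    from this[OF powr_ge_zero l] show "0 < k" "(e / \<kappa>) powr (1 / p) < k" "k < l"
      unfolding k_def by blast+
  qed
  have "((e / \<kappa>) powr (1 / p)) powr p < k powr p"
    using k p by (intro powr_less_mono2) auto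
  then have ek: "e / k powr p < \<kappa>"
    using k p e(2) \<kappa> by (simp add: powr_powr pos_divide_less_eq mult.commute)
  \<comment> \<open>The minimum bounds the function, and the subtraction confines its support to
    \<open>{\<bar>u\<bar> > 1 / Suc n}\<close>, a set of finite measure. Both operations are
    1-Lipschitz, so the energy does not grow.\<close>
  define v where "v n x = max 0 (min \<bar>u x\<bar> (real n) - 1 / real (Suc n)) / k" for n x
  have [measurable]: "v n \<in> borel_measurable borel" for n
    unfolding v_def by measurable
  have v_le_1: "(\<integral>\<^sup>+ x. ennreal (f (v n x)) \<partial>lborel) \<le> 1" for n
  proof (rule ccontr)
    assume neg: "\<not> ?thesis"
    have "ennreal \<kappa> \<le> (\<integral>\<^sup>+ x. \<integral>\<^sup>+ y. ennreal (\<bar>v n x - v n y\<bar> powr p) * G (x - y) \<partial>lborel \<partial>lborel)"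
      unfolding \<kappa>_def
    \<comment> \<open>The top level uses \<open>Suc n\<close> instead of \<open>n\<close> because it
      must be positive for \<open>n = 0\<close> too.\<close>
    proof (rule energy_lower_bound[OF t, of "real (Suc n) / k"])
      show "v n x \<le> real (Suc n) / k" for x
      proof -
        have "0 \<le> 1 / real (Suc n)" by simp
        then have "max 0 (min \<bar>u x\<bar> (real n) - 1 / real (Suc n)) \<le> real (Suc n)"
          unfolding of_nat_Suc by linarith
        then show ?thesis
          unfolding v_def using k by (intro divide_right_mono) auto
      qed
      have "{x. 0 < v n x} \<subseteq> {x. 1 / real (Suc n) < \<bar>u x\<bar>}"
        using k by (auto simp: v_def zero_less_divide_iff)
      then have "emeasure lborel {x. 0 < v n x} \<le> emeasure lborel {x. 1 / real (Suc n) < \<bar>u x\<bar>}"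
        by (intro emeasure_mono) auto
      also have "\<dots> < \<infinity>" by (rule fin) auto
      finally show "emeasure lborel {x. 0 < v n x} < \<infinity>" .
    qed (use k neg kernel in auto)
    also have "\<dots> \<le> (\<integral>\<^sup>+ x. \<integral>\<^sup>+ y. ennreal (1 / k powr p) * (ennreal (\<bar>u x - u y\<bar> powr p) * G (x - y)) \<partial>lborel \<partial>lborel)"
    proof (intro nn_integral_mono)
      fix x y
      have "\<bar>v n x - v n y\<bar> = \<bar>max 0 (min \<bar>u x\<bar> (real n) - 1 / real (Suc n)) - max 0 (min \<bar>u y\<bar> (real n) - 1 / real (Suc n))\<bar> / k"
        using k by (simp add: v_def diff_divide_distrib[symmetric])
      also have "\<dots> \<le> \<bar>u x - u y\<bar> / k"
      proof (rule divide_right_mono)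
        have "\<bar>max 0 (min a c - d) - max 0 (min b c - d)\<bar> \<le> \<bar>a - b\<bar>" for a b c d :: real
          by linarith
        then show "\<bar>max 0 (min \<bar>u x\<bar> (real n) - 1 / real (Suc n)) - max 0 (min \<bar>u y\<bar> (real n) - 1 / real (Suc n))\<bar> \<le> \<bar>u x - u y\<bar>"
          by (rule order.trans) (rule abs_triangle_ineq3)
      qed (use k in simp)
      finally have "\<bar>v n x - v n y\<bar> powr p \<le> (\<bar>u x - u y\<bar> / k) powr p"
        using p by (intro powr_mono2) auto
      also have "\<dots> = 1 / k powr p * \<bar>u x - u y\<bar> powr p"
        using k by (simp add: powr_divide)
      finally have "ennreal (\<bar>v n x - v n y\<bar> powr p) \<le> ennreal (1 / k powr p) * ennreal (\<bar>u x - u y\<bar> powr p)"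
        by (simp add: ennreal_mult'[symmetric] ennreal_leI)
      then show "ennreal (\<bar>v n x - v n y\<bar> powr p) * G (x - y) \<le> ennreal (1 / k powr p) * (ennreal (\<bar>u x - u y\<bar> powr p) * G (x - y))"
        unfolding mult.assoc[symmetric] by (rule mult_right_mono) simp
    qed
    also have "\<dots> = ennreal (1 / k powr p) * ennreal e"
      by (simp add: nn_integral_cmult e(1)[symmetric])
    also have "\<dots> = ennreal (e / k powr p)"
      by (simp add: ennreal_mult'[symmetric])
    finally show False
      using ek \<kappa> e(2) by (simp add: ennreal_le_iff2)
  qed
  have "(\<integral>\<^sup>+ x. ennreal (f (\<bar>u x\<bar> / l)) \<partial>lborel) \<le> (\<integral>\<^sup>+ x. liminf (\<lambda>n. ennreal (f (v n x))) \<partial>lborel)"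
  proof (intro nn_integral_mono Liminf_bounded)
    fix x
    have "\<forall>\<^sub>F n in sequentially. \<bar>u x\<bar> / l \<le> v n x"
    proof (cases "u x = 0")
      case True
      then show ?thesis using k by (simp add: v_def)
    next
      case False
      have "(\<lambda>n. (\<bar>u x\<bar> - 1 / real (Suc n)) / k) \<longlonglongrightarrow> (\<bar>u x\<bar> - 0) / k"
        using LIMSEQ_inverse_real_of_nat by (intro tendsto_intros) (auto simp: inverse_eq_divide k less_imp_neq[symmetric])
      moreover have "\<bar>u x\<bar> / l < (\<bar>u x\<bar> - 0) / k"
        using k False by (simp add: divide_strict_left_mono)
      ultimately have "\<forall>\<^sub>F n in sequentially. \<bar>u x\<bar> / l < (\<bar>u x\<bar> - 1 / real (Suc n)) / k"
        by (rule order_tendstoD(1))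
      moreover have "\<forall>\<^sub>F n in sequentially. \<bar>u x\<bar> \<le> real n"
        using eventually_ge_at_top[of "nat \<lceil>\<bar>u x\<bar>\<rceil>"] by eventually_elim linarith
      ultimately show ?thesis
      proof eventually_elim
        case (elim n)
        then have "\<bar>u x\<bar> / l \<le> (min \<bar>u x\<bar> (real n) - 1 / real (Suc n)) / k"
          by (simp add: min_absorb1)
        also have "\<dots> \<le> v n x"
          unfolding v_def using k by (intro divide_right_mono) auto
        finally show ?case .
      qed
    qed
    then show "\<forall>\<^sub>F n in sequentially. ennreal (f (\<bar>u x\<bar> / l)) \<le> ennreal (f (v n x))"
      by eventually_elim (intro ennreal_leI monoD[OF mono_f])
  qed
  also have "\<dots> \<le> liminf (\<lambda>n. \<integral>\<^sup>+ x. ennreal (f (v n x)) \<partial>lborel)"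
    by (rule nn_integral_liminf) measurable
  also have "\<dots> \<le> liminf (\<lambda>n. 1)"
    using v_le_1 by (intro Liminf_mono) auto
  also have "\<dots> = 1"
    by (rule Liminf_const) simp
  finally show ?thesis .
qed

end

section \<open>The embedding inequality: passage to real-valued Borel data\<close>

theorem theorem3p10:
  fixes \<nu> :: "'a::euclidean_space \<Rightarrow> real" and p \<theta> t :: real and w :: "real \<Rightarrow> real"
    and \<phi> :: "ennreal \<Rightarrow> ennreal" and u :: "'a \<Rightarrow> real"
  defines "w \<equiv> potential p \<nu>" and "\<phi> \<equiv> phi w"
  assumes "1 \<le> p"
    and "\<nu> \<in> borel_measurable (lebesgue_on (- {0}))"
    and "\<And>h. h \<noteq> 0 \<Longrightarrow> 0 \<le> \<nu> h"
    and "\<And>r. 0 < r \<Longrightarrow> nu_sharp \<nu> r < \<infinity>"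
    and "bij_betw w {0..} {0..}"
    and "young_function (\<lambda>s. \<phi> (s epowr (1 / p)))"
    and "0 < \<theta>"
    and "\<And>a b::real. 0 \<le> a \<Longrightarrow> a \<le> b \<Longrightarrow> 0 < b \<Longrightarrow>
           \<phi> (ennreal (\<theta> * (a / b))) \<le> \<phi> (ennreal a) / \<phi> (ennreal b)"
    and "2 \<le> t" and "p = 1 \<Longrightarrow> 2 < t"
    and "u \<in> orlicz_space \<phi>"
  shows "luxemburg_norm \<phi> u
     \<le> ennreal (Theta_const \<phi> p \<theta> t) *
       (\<integral>\<^sup>+ x. \<integral>\<^sup>+ y. ennreal (\<bar>u x - u y\<bar> powr p * \<nu> (x - y)) \<partial>lebesgue \<partial>lebesgue) epowr (1 / p)"
proof -
  note p = \<open>1 \<le> p\<close> and \<nu> = assms(4) and \<nu>_nonneg = assms(5) and \<nu>_fin = assms(6)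
    and bij = assms(7) and young = assms(8) and \<theta> = \<open>0 < \<theta>\<close> and submult = assms(10)
    and t = \<open>2 \<le> t\<close> and tp = assms(12) and u = assms(13)
  have w0: "w 0 = 0" by (simp add: w_def potential_def)
  define iw where "iw = the_inv_into {0..} w"
  have iw: "0 \<le> iw y" "w (iw y) = y" if "0 \<le> y" for y
    using that bij the_inv_into_into[of w "{0..}" y "{0..}"] f_the_inv_into_f[of w "{0..}" y]
    by (auto simp: iw_def bij_betw_def)
  have iw_w: "iw (w r) = r" if "0 \<le> r" for r
    using that bij the_inv_into_f_f[of w "{0..}" r] by (auto simp: iw_def bij_betw_def)
  have w_pos: "0 < w r" if "0 < r" for r
  proof -
    have "0 \<le> w r" using bij that by (auto simp: bij_betw_def)
    moreover have "w r \<noteq> 0"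
      using iw_w[of r] iw_w[of 0] w0 that by auto
    ultimately show ?thesis by simp
  qed
  have iw_pos: "0 < iw y" if "0 < y" for y
    using iw[of y] w0 that by (cases "iw y = 0") auto
  define f where "f x = (if x \<le> 0 then 0 else 1 / iw (1 / x))" for x
  have f_nonneg: "0 \<le> f x" for x
    using iw(1)[of "1 / x"] by (auto simp: f_def)
  have \<phi>_f: "\<phi> (ennreal x) = ennreal (f x)" if "0 \<le> x" for x
  proof (cases "x = 0")
    case False
    with that have x: "0 < x" by simp
    then have "enn2real (1 / ennreal x) = 1 / x"
      by (simp add: ennreal_1[symmetric] divide_ennreal del: ennreal_1)
    then have "\<phi> (ennreal x) = 1 / ennreal (iw (1 / x))"
      using x by (simp add: \<phi>_def phi_def iw_def)
    also have "\<dots> = ennreal (f x)"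
      using x iw_pos[of "1 / x"] by (simp add: f_def ennreal_1[symmetric] divide_ennreal del: ennreal_1)
    finally show ?thesis .
  qed (simp add: \<phi>_def phi_def f_def)
  define N where "N r = enn2real (nu_sharp \<nu> r)" for r
  interpret growth_profile p \<theta> f w N
  proof
    show "convex_on {0..} (\<lambda>y. f (y powr (1 / p)))"
    proof (rule convex_onI)
      fix a x y :: real assume a: "0 < a" "a < 1" and xy: "x \<in> {0..}" "y \<in> {0..}"
      have "\<phi> ((ennreal (1 - a) * ennreal x + ennreal (1 - (1 - a)) * ennreal y) epowr (1 / p))
          \<le> ennreal (1 - a) * \<phi> (ennreal x epowr (1 / p)) + ennreal (1 - (1 - a)) * \<phi> (ennreal y epowr (1 / p))"
        using young a unfolding young_function_def by (metis diff_ge_0_iff_ge diff_le_eq less_imp_le le_add_same_cancel1)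
      moreover have "ennreal (1 - a) * ennreal x + ennreal (1 - (1 - a)) * ennreal y = ennreal ((1 - a) * x + a * y)"
        using a xy by (simp add: ennreal_mult)
      moreover have "\<phi> (ennreal z epowr (1 / p)) = ennreal (f (z powr (1 / p)))" if "0 \<le> z" for z
        using that by (simp add: ennpowr_def \<phi>_f)
      ultimately have "ennreal (f (((1 - a) * x + a * y) powr (1 / p)))
          \<le> ennreal (1 - a) * ennreal (f (x powr (1 / p))) + ennreal a * ennreal (f (y powr (1 / p)))"
        using a xy by (simp del: ennreal_plus)
      also have "\<dots> = ennreal ((1 - a) * f (x powr (1 / p)) + a * f (y powr (1 / p)))"
        using a f_nonneg by (simp add: ennreal_mult ennreal_plus)
      finally show "f (((1 - a) *\<^sub>R x + a *\<^sub>R y) powr (1 / p)) \<le> (1 - a) * f (x powr (1 / p)) + a * f (y powr (1 / p))"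
        using a f_nonneg by (simp add: ennreal_le_iff del: ennreal_plus)
    qed simp
  next
    fix r :: real assume r: "0 < r"
    show "f (1 / w r) = 1 / r"
      using r w_pos[OF r] by (simp add: f_def iw_w not_le)
    show "w r powr p = r * N r"
      using r p by (simp add: w_def potential_def N_def powr_powr)
  next
    fix a b :: real assume ab: "0 \<le> a" "a \<le> b" "0 < b"
    have fb: "0 < f b" using ab iw_pos[of "1 / b"] by (simp add: f_def)
    have "ennreal (f (\<theta> * (a / b))) \<le> ennreal (f a) / ennreal (f b)"
      using submult[OF ab] ab \<theta> by (simp add: \<phi>_f)
    also have "\<dots> = ennreal (f a / f b)"
      using fb f_nonneg by (simp add: divide_ennreal)
    finally show "f (\<theta> * (a / b)) \<le> f a / f b"
      using fb f_nonneg by (simp add: ennreal_le_iff)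
  qed (use p \<theta> w0 w_pos iw_pos in \<open>auto simp: f_def\<close>)
  have [measurable]: "f \<in> borel_measurable borel"
    by (rule borel_measurable_mono[OF mono_f])

  define g where "g h = ennreal (if h = 0 then 0 else \<nu> h)" for h
  have "g \<in> borel_measurable lebesgue"
    unfolding g_def using borel_measurable_extend_zero[OF \<nu>] by measurable
  \<comment> \<open>\<open>(x, y) \<mapsto> g (x - y)\<close> need not be measurable for the product of two copies of Lebesgue measure, so
    Tonelli's theorem is only available for Borel representatives.\<close>
  then obtain G where G[measurable]: "G \<in> borel_measurable borel" and gG: "AE h in lborel. g h = G h"
    using completion_ex_borel_measurable[of g lborel] by auto
  have "u \<in> borel_measurable lebesgue"
    using u by (simp add: orlicz_space_def)
  then obtain u' where u'[measurable]: "u' \<in> borel_measurable borel" and uu': "AE x in lborel. u x = u' x"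
    using completion_ex_borel_measurable_real[of u lborel] by auto
  have modular: "(\<integral>\<^sup>+ x. \<phi> (ennreal (\<bar>u x\<bar> / l)) \<partial>lebesgue) = (\<integral>\<^sup>+ x. ennreal (f (\<bar>u' x\<bar> / l)) \<partial>lborel)"
    if "0 < l" for l
  proof -
    have "AE x in lborel. \<phi> (ennreal (\<bar>u x\<bar> / l)) = ennreal (f (\<bar>u' x\<bar> / l))"
      using uu' by eventually_elim (use that in \<open>simp add: \<phi>_f\<close>)
    then show ?thesis
      unfolding nn_integral_completion by (rule nn_integral_cong_AE)
  qed
  define E where "E = (\<integral>\<^sup>+ x. \<integral>\<^sup>+ y. ennreal (\<bar>u' x - u' y\<bar> powr p) * G (x - y) \<partial>lborel \<partial>lborel)"
  \<comment> \<open>\<open>nn_integral_completion\<close> holds for arbitrary integrands, so both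
    integrals can be taken over \<open>lborel\<close> before any measurability is known.\<close>
  have E: "(\<integral>\<^sup>+ x. \<integral>\<^sup>+ y. ennreal (\<bar>u x - u y\<bar> powr p * \<nu> (x - y)) \<partial>lebesgue \<partial>lebesgue) = E"
    unfolding nn_integral_completion E_def
  proof (rule nn_integral_cong_AE)
    show "AE x in lborel. (\<integral>\<^sup>+ y. ennreal (\<bar>u x - u y\<bar> powr p * \<nu> (x - y)) \<partial>lborel)
       = (\<integral>\<^sup>+ y. ennreal (\<bar>u' x - u' y\<bar> powr p) * G (x - y) \<partial>lborel)"
      using uu'
    proof eventually_elim
      case (elim x)
      have eq: "lborel = distr lborel borel (\<lambda>y. x + (-1) *\<^sub>R y)"
        using lborel_affine[of "-1" x] by (simp add: density_1)
      \<comment> \<open>For fixed \<open>x\<close>, reflection and translation carry the null set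
        where \<open>g\<close> and \<open>G\<close> differ to a null set in
        \<open>y\<close>.\<close>
      have "AE y in lborel. g (x + (-1) *\<^sub>R y) = G (x + (-1) *\<^sub>R y)"
        using AE_distrD[of "\<lambda>y. x + (-1) *\<^sub>R y" lborel borel "\<lambda>h. g h = G h"] gG
        unfolding eq[symmetric] by simp
      with uu' have "AE y in lborel. ennreal (\<bar>u x - u y\<bar> powr p * \<nu> (x - y)) = ennreal (\<bar>u' x - u' y\<bar> powr p) * G (x - y)"
      proof eventually_elim
        case (elim y)
        \<comment> \<open>On the diagonal the factor \<open>\<bar>u x - u y\<bar> powr p\<close>
          vanishes, so the value of \<open>\<nu>\<close> at the origin has no influence.\<close>
        have "ennreal (\<bar>u x - u y\<bar> powr p * \<nu> (x - y)) = ennreal (\<bar>u x - u y\<bar> powr p) * g (x - y)"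
          using p by (cases "x = y") (auto simp: g_def ennreal_mult')
        then show ?case
          using elim \<open>u x = u' x\<close> by simp
      qed
      then show ?case
        by (rule nn_integral_cong_AE)
    qed
  qed
  have kernel: "ennreal (N r) \<le> (\<integral>\<^sup>+ h \<in> - D. G h \<partial>lborel)"
    if "0 < r" "D \<in> sets borel" "emeasure lborel D = ennreal r" for r D
  proof -
    have "ennreal (N r) = nu_sharp \<nu> r"
      using \<nu>_fin[OF that(1)] by (simp add: N_def)
    also have "\<dots> \<le> (\<integral>\<^sup>+ h \<in> - D. g h \<partial>lebesgue)"
      unfolding g_def using that \<nu> \<nu>_nonneg \<nu>_fin by (intro nu_sharp_le) auto
    also have "\<dots> = (\<integral>\<^sup>+ h \<in> - D. G h \<partial>lborel)"
      unfolding nn_integral_completion using gG by (intro nn_integral_cong_AE) auto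
    finally show ?thesis .
  qed
  \<comment> \<open>Chebyshev's inequality for the finite modular of an element of the Orlicz
    space.\<close>
  have fin: "emeasure lborel {x. s < \<bar>u' x\<bar>} < \<infinity>" if "0 < s" for s
  proof -
    obtain l where l: "0 < l" "(\<integral>\<^sup>+ x. \<phi> (ennreal (\<bar>u x\<bar> / l)) \<partial>lebesgue) < \<infinity>"
      using u by (auto simp: orlicz_space_def)
    have "ennreal (f (s / l)) * emeasure lborel {x. s < \<bar>u' x\<bar>}
        = (\<integral>\<^sup>+ x. ennreal (f (s / l)) * indicator {x. s < \<bar>u' x\<bar>} x \<partial>lborel)"
      by (subst nn_integral_cmult_indicator) auto
    also have "\<dots> \<le> (\<integral>\<^sup>+ x. ennreal (f (\<bar>u' x\<bar> / l)) \<partial>lborel)"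
      using l(1) by (intro nn_integral_mono)
        (auto simp: indicator_def intro!: ennreal_leI monoD[OF mono_f] divide_right_mono)
    also have "\<dots> < \<infinity>"
      using l modular[OF l(1)] by simp
    finally show ?thesis
      using f_pos[of "s / l"] l(1) \<open>0 < s\<close> by (auto simp: ennreal_mult_less_top)
  qed
  define X where "X = t powr p"
  \<comment> \<open>This makes \<open>C_const p t\<close> positive; for \<open>p = 1\<close> it is
    the requirement \<open>2 < t\<close>.\<close>
  have X: "2 < X"
  proof (cases "p = 1")
    case True
    then show ?thesis using tp t by (simp add: X_def)
  next
    case False
    then have "t powr 1 < t powr p" using p t by (intro powr_less_mono) auto
    then show ?thesis using t by (simp add: X_def)
  qed
  define F where "F = f (\<theta> / t)"
  have F: "0 < F" using f_pos[of "\<theta> / t"] \<theta> t by (simp add: F_def)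
  \<comment> \<open>The argument yields the factor \<open>1 - 1 / X\<close>; the stated constant is
    smaller because \<open>X * (X - 2) \<le> (X - 1)^2\<close>.\<close>
  have C: "0 < C_const p t" "C_const p t \<le> 1 - t powr - p"
    using X by (auto simp: C_const_def X_def[symmetric] powr_minus field_simps power2_eq_square)
  have \<Theta>: "Theta_const \<phi> p \<theta> t = t * (2 * C_const p t * F) powr (- 1 / p)"
    using \<theta> t f_nonneg by (simp add: Theta_const_def \<phi>_f F_def)
  then have \<Theta>_pos: "0 < Theta_const \<phi> p \<theta> t"
    using C F t by simp
  show ?thesis
  proof (cases "E = \<infinity>")
    case True
    then show ?thesis
      unfolding E using \<Theta>_pos by (simp add: ennpowr_def ennreal_mult_top)
  next
    case False
    then obtain e where e: "E = ennreal e" "0 \<le> e" by (cases E) auto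
    define \<kappa> where "\<kappa> = 2 * (1 - t powr - p) * f (\<theta> / t) / t powr p"
    define R where "R = Theta_const \<phi> p \<theta> t * e powr (1 / p)"
    have "(e / \<kappa>) powr (1 / p) \<le> (e / (2 * C_const p t * F / X)) powr (1 / p)"
      unfolding \<kappa>_def F_def[symmetric] X_def[symmetric]
      using C F X e p by (intro powr_mono2 divide_left_mono divide_right_mono mult_right_mono mult_left_mono) auto
    also have "\<dots> = R"
    proof -
      have "(e / (2 * C_const p t * F / X)) powr (1 / p) = X powr (1 / p) * e powr (1 / p) / (2 * C_const p t * F) powr (1 / p)"
        using C F X e by (simp add: powr_divide powr_mult)
      also have "X powr (1 / p) = t"
        using t p by (simp add: X_def powr_powr)
      finally show ?thesis
        using C F by (simp add: R_def \<Theta> powr_minus_divide)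
    qed
    finally have R: "(e / \<kappa>) powr (1 / p) \<le> R" .
    \<comment> \<open>The slack \<open>\<epsilon>\<close> provides the strict inequality required by
      \<open>modular_le_1\<close>, and a positive scale when \<open>R = 0\<close>.\<close>
    have "luxemburg_norm \<phi> u \<le> ennreal R + ennreal \<epsilon>" if "0 < \<epsilon>" for \<epsilon>
    proof -
      have R0: "0 \<le> R" using \<Theta>_pos by (simp add: R_def)
      have "(\<integral>\<^sup>+ x. ennreal (f (\<bar>u' x\<bar> / (R + \<epsilon>))) \<partial>lborel) \<le> 1"
        using kernel fin e R that unfolding E_def \<kappa>_def
        by (intro modular_le_1[OF t G u', of e]) auto
      then have "(\<integral>\<^sup>+ x. \<phi> (ennreal (\<bar>u x\<bar> / (R + \<epsilon>))) \<partial>lebesgue) \<le> 1"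
        using R0 that by (simp add: modular)
      then have "luxemburg_norm \<phi> u \<le> ennreal (R + \<epsilon>)"
        unfolding luxemburg_norm_def using R0 that
        by (intro Inf_lower CollectI exI[where x="R + \<epsilon>"] conjI refl) linarith+
      then show ?thesis
        using R0 that by simp
    qed
    then have "luxemburg_norm \<phi> u \<le> ennreal R"
      by (rule ennreal_le_epsilon)
    also have "\<dots> = ennreal (Theta_const \<phi> p \<theta> t) * E epowr (1 / p)"
      using e(2) \<Theta>_pos unfolding e(1) R_def ennpowr_def by (subst ennreal_mult) simp_all
    finally show ?thesis unfolding E .
  qed
qed

end
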